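(* Assume the regularity, growth, convexity and constraint-smoothness assumptions on $f$ and $g$ and the standing non-triviality assumptions listed in the context. For all $T\ge0$, the sets $\partial\mathcal A_T\cap G_-$ and $\partial\mathcal A\cap G_-$ are semipermeable relative to $G$ (and the system $\dot x=f(x,u)$, $u\in\mathcal U$).
   Context: Let $n,m,p\ge 1$, $U_1=\{v\in\mathbb R^m:\|v\|\le 1\}$ (Euclidean norm), and let $\mathcal U$ be the set of Lebesgue measurable functions from $[0,\infty)$ to $U_1$. For $u\in\mathcal U$ and $x_0\in\mathbb R^n$, $x^{(u,x_0)}$ denotes the solution of $\dot x(t)=f(x(t),u(t))$, $x(0)=x_0$. The constraint function is $g=(g_1,\dots,g_p):\mathbb R^n\to\mathbb R^p$. Assumptions. (A1) $f(\cdot,u)$ is an at least $C^2$ vector field on $\mathbb R^n$ for every $u$ in an open subset of $\mathbb R^m$ containing $U_1$, and its dependence on $u$ is also at least $C^2$. (A2) There is a constant $0<C<\infty$ such that either $\sup_{u\in U_1}\|f(x,u)\|\le C(1+\|x\|)$ for all $x$, or $\sup_{u\in U_1}|x^Tf(x,u)|\le C(1+\|x\|^2)$ for all $x$. (A3) The set $f(x,U_1)$ is convex for all $x\in\mathbb R^n$. (A4) $g$ is at least $C^2$, and for each $i$ the set $\{x: g_i(x)=0\}$ is an $(n-1)$-dimensional manifold. Notation. $G=\{x: g_i(x)\le 0,\ i=1,\dots,p\}$ (assumed to have nonempty interior); $G_-=\{x: g_i(x)<0\text{ for all }i\}$. Admissible sets: $\mathcal A=\{\bar x\in G:\exists u\in\mathcal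 U,\ g_i(x^{(u,\bar x)}(t))\le 0\ \forall i,\ \forall t\ge0\}$ and, for finite $T\ge0$, $\mathcal A_T=\{\bar x\in G:\exists u\in\mathcal U,\ g_i(x^{(u,\bar x)}(t))\le 0\ \forall i,\ \forall t\in[0,T]\}$; complements $\mathcal A^{\mathsf C}=G\setminus\mathcal A$, $\mathcal A_T^{\mathsf C}=G\setminus\mathcal A_T$. Boundaries are relative to the topology of $G$. Standing assumptions: $\mathcal A\ne\emptyset$ and $\mathcal A^{\mathsf C}\neq\emptyset$. Semipermeability. The boundary $\partial A$ (relative to $B$) of a closed set $A\subset B\subset\mathbb R^n$ is called semipermeable relative to $B$ (and the system) if and only if no integral curve of the system starting in $A^{\mathsf C}\cap B$ can penetrate $A$ before leaving $B$, i.e. if and only if for all $x_0\in A^{\mathsf C}\cap B$, all $u\in\mathcal U$ and all $t\ge 0$ such that $x^{(u,x_0)}(s)\in B$ for all $s\in[0,t]$, one has $x^{(u,x_0)}(t)\in A^{\mathsf C}$. Semipermeability of the boundary portions $\partial\mathcal A_T\cap G_-$ and $\partial\mathcal A\cap G_-$ relative to $G$ is understood as this condition with $B=G$ and $A=\mathcal A_T$, respectively $A=\mathcal A$. *)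

theory Defs
  imports "HOL-Analysis.Analysis"
begin

section \<open>Regularity\<close>

text \<open>Both notions are meant for an open set \<open>S\<close>.\<close>

definition C1_on :: "('a::real_normed_vector \<Rightarrow> 'b::real_normed_vector) \<Rightarrow> 'a set \<Rightarrow> bool" where
  "C1_on h S \<longleftrightarrow>
     (\<exists>h' :: 'a \<Rightarrow> 'a \<Rightarrow>\<^sub>L 'b.
        (\<forall>x\<in>S. (h has_derivative blinfun_apply (h' x)) (at x)) \<and> continuous_on S h')"

definition C2_on :: "('a::real_normed_vector \<Rightarrow> 'b::real_normed_vector) \<Rightarrow> 'a set \<Rightarrow> bool" where
  "C2_on h S \<longleftrightarrow>
     (\<exists>h' :: 'a \<Rightarrow> 'a \<Rightarrow>\<^sub>L 'b.
        (\<forall>x\<in>S. (h has_derivative blinfun_apply (h' x)) (at x)) \<and> C1_on h' S)"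

text \<open>A topological manifold of dimension \<open>k\<close> with the subspace topology. The Hausdorff
  property and second countability are inherited from the ambient Euclidean space, so only the
  local charts have to be required.\<close>

definition manifold_of_dim :: "nat \<Rightarrow> 'a::euclidean_space set \<Rightarrow> bool" where
  "manifold_of_dim k S \<longleftrightarrow>
     (\<forall>q\<in>S. \<exists>W V. openin (top_of_set S) W \<and> q \<in> W \<and> openin (Euclidean_space k) V \<and>
        top_of_set W homeomorphic_space subtopology (Euclidean_space k) V)"

section \<open>Controls and solutions\<close>

definition U1 :: "(real ^ 'm) set" where
  "U1 = {v. norm v \<le> 1}"

text \<open>Controls and solutions live on the half-line; their values at negative times
  are irrelevant.\<close>

definition controls :: "(real \<Rightarrow> real ^ 'm) set" where
  "controls = {u. u \<in> borel_measurable (lebesgue_on {0..}) \<and> (\<forall>t\<ge>0. u t \<in> U1)}"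

definition absolutely_continuous_on_interval ::
    "real \<Rightarrow> real \<Rightarrow> (real \<Rightarrow> 'a::real_normed_vector) \<Rightarrow> bool" where
  "absolutely_continuous_on_interval a b x \<longleftrightarrow>
     (\<forall>\<epsilon>>0. \<exists>\<delta>>0. \<forall>(N::nat) l r.
        (\<forall>i<N. a \<le> l i \<and> l i \<le> r i \<and> r i \<le> b) \<longrightarrow>
        (\<forall>i<N. \<forall>j<N. i \<noteq> j \<longrightarrow> {l i<..<r i} \<inter> {l j<..<r j} = {}) \<longrightarrow>
        (\<Sum>i<N. r i - l i) < \<delta> \<longrightarrow>
        (\<Sum>i<N. norm (x (r i) - x (l i))) < \<epsilon>)"

text \<open>As \<open>u\<close> is merely measurable, solutions are understood in the sense of Caratheodory:
  locally absolutely continuous, satisfying the differential equation almost everywhere.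
  Under \<open>smooth_dynamics\<close> and \<open>growth_bound\<close> below there is exactly one such solution on
  the half-line for each control and initial value (unique up to its values at negative
  times).\<close>

definition is_solution ::
    "(real ^ 'n \<Rightarrow> real ^ 'm \<Rightarrow> real ^ 'n) \<Rightarrow> (real \<Rightarrow> real ^ 'm) \<Rightarrow> real ^ 'n
      \<Rightarrow> (real \<Rightarrow> real ^ 'n) \<Rightarrow> bool" where
  "is_solution f u x0 x \<longleftrightarrow>
     x 0 = x0 \<and>
     (\<forall>T\<ge>0. absolutely_continuous_on_interval 0 T x) \<and>
     (AE t in lebesgue_on {0..}. (x has_vector_derivative f (x t) (u t)) (at t within {0..}))"

section \<open>Assumptions on the data\<close>

text \<open>Twice continuous differentiability is required jointly in the state and the control.\<close>

definition smooth_dynamics :: "(real ^ 'n \<Rightarrow> real ^ 'm \<Rightarrow> real ^ 'n) \<Rightarrow> bool" where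
  "smooth_dynamics f \<longleftrightarrow>
     (\<exists>D. open D \<and> U1 \<subseteq> D \<and> C2_on (\<lambda>(x, v). f x v) (UNIV \<times> D))"

text \<open>The bounds on the suprema over \<open>U1\<close> are stated pointwise, because the supremum of an
  unbounded set of reals is not infinite but unspecified.\<close>

definition growth_bound :: "(real ^ 'n \<Rightarrow> real ^ 'm \<Rightarrow> real ^ 'n) \<Rightarrow> bool" where
  "growth_bound f \<longleftrightarrow>
     (\<exists>C>0. (\<forall>x. \<forall>v\<in>U1. norm (f x v) \<le> C * (1 + norm x)) \<or>
            (\<forall>x. \<forall>v\<in>U1. \<bar>x \<bullet> f x v\<bar> \<le> C * (1 + (norm x)\<^sup>2)))"

definition convex_velocities :: "(real ^ 'n \<Rightarrow> real ^ 'm \<Rightarrow> real ^ 'n) \<Rightarrow> bool" where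
  "convex_velocities f \<longleftrightarrow> (\<forall>x. convex (f x ` U1))"

definition smooth_constraints :: "(real ^ 'n \<Rightarrow> real ^ 'p) \<Rightarrow> bool" where
  "smooth_constraints g \<longleftrightarrow>
     C2_on g UNIV \<and> (\<forall>i. manifold_of_dim (CARD('n) - 1) {x. g x $ i = 0})"

section \<open>Admissible sets\<close>

definition constraint_set :: "(real ^ 'n \<Rightarrow> real ^ 'p) \<Rightarrow> (real ^ 'n) set" where
  "constraint_set g = {x. \<forall>i. g x $ i \<le> 0}"

definition admissible_set ::
    "(real ^ 'n \<Rightarrow> real ^ 'm \<Rightarrow> real ^ 'n) \<Rightarrow> (real ^ 'n \<Rightarrow> real ^ 'p) \<Rightarrow> (real ^ 'n) set" where
  "admissible_set f g =
     {y \<in> constraint_set g. \<exists>u\<in>controls. \<exists>x. is_solution f u y x \<and>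
        (\<forall>i. \<forall>t\<ge>0. g (x t) $ i \<le> 0)}"

definition admissible_set_upto ::
    "(real ^ 'n \<Rightarrow> real ^ 'm \<Rightarrow> real ^ 'n) \<Rightarrow> (real ^ 'n \<Rightarrow> real ^ 'p) \<Rightarrow> real
      \<Rightarrow> (real ^ 'n) set" where
  "admissible_set_upto f g T =
     {y \<in> constraint_set g. \<exists>u\<in>controls. \<exists>x. is_solution f u y x \<and>
        (\<forall>i. \<forall>t\<in>{0..T}. g (x t) $ i \<le> 0)}"

section \<open>Semipermeability\<close>

text \<open>Semipermeability relative to \<open>B\<close> of the boundary of \<open>A \<subseteq> B\<close> (and of portions of that
  boundary) is by definition the following condition on \<open>A\<close> and \<open>B\<close>, in which the boundary
  itself does not occur.\<close>

definition semipermeable_boundary ::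
    "(real ^ 'n \<Rightarrow> real ^ 'm \<Rightarrow> real ^ 'n) \<Rightarrow> (real ^ 'n) set \<Rightarrow> (real ^ 'n) set \<Rightarrow> bool" where
  "semipermeable_boundary f B A \<longleftrightarrow>
     (\<forall>x0 \<in> B - A. \<forall>u\<in>controls. \<forall>x. is_solution f u x0 x \<longrightarrow>
        (\<forall>t\<ge>0. (\<forall>s\<in>{0..t}. x s \<in> B) \<longrightarrow> x t \<in> B - A))"

end

theory Submission
  imports Defs
begin

text \<open>
  If a trajectory that starts outside an admissible set and stays in the constraint set could
  reach, at time \<open>t\<close>, a point of the admissible set, then one could follow it up to time \<open>t\<close> and
  afterwards follow an admissible trajectory from the point reached. The concatenation would
  satisfy the constraints as long as the second trajectory does and for an additional time \<open>t\<close>,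
  so the starting point would have been admissible after all. For the finite horizon
  \<open>T\<close> the surplus is simply discarded, whether \<open>t\<close> lies before or after \<open>T\<close>.

  The analytic content is thus that the system is autonomous and its controls and solutions are
  closed under concatenation: \<open>concatenate_controls\<close> uses that Lebesgue measurability is
  translation invariant, and \<open>is_solution_concatenate\<close> that absolute continuity survives
  gluing (\<open>absolutely_continuous_concatenate\<close>) and that null sets are translation invariant.
  The implications "reached point admissible, hence starting point admissible" are
  \<open>admissible_set_upto_backward\<close> and \<open>admissible_set_backward\<close>; semipermeability is their
  contraposition.
\<close>

text \<open>
  The value at the gluing time is the one of the first function. For a solution and its
  continuation the two candidates agree; for controls a single time does not matter.
\<close>

definition concatenate :: "real \<Rightarrow> (real \<Rightarrow> 'a) \<Rightarrow> (real \<Rightarrow> 'a) \<Rightarrow> real \<Rightarrow> 'a" where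
  "concatenate t x y s = (if s \<le> t then x s else y (s - t))"

section \<open>Absolute continuity\<close>

definition nonoverlapping_intervals ::
    "real \<Rightarrow> real \<Rightarrow> nat \<Rightarrow> (nat \<Rightarrow> real) \<Rightarrow> (nat \<Rightarrow> real) \<Rightarrow> bool" where
  "nonoverlapping_intervals a b N l r \<longleftrightarrow>
     (\<forall>i<N. a \<le> l i \<and> l i \<le> r i \<and> r i \<le> b) \<and>
     (\<forall>i<N. \<forall>j<N. i \<noteq> j \<longrightarrow> {l i<..<r i} \<inter> {l j<..<r j} = {})"

lemma absolutely_continuous_on_intervalE:
  assumes "absolutely_continuous_on_interval a b x" and "\<epsilon> > 0"
  obtains \<delta> where "\<delta> > 0"
    and "\<forall>N l r. nonoverlapping_intervals a b N l r \<longrightarrow> (\<Sum>i<N. r i - l i) < \<delta> \<longrightarrow>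
      (\<Sum>i<N. norm (x (r i) - x (l i))) < \<epsilon>"
  using assms(1)[unfolded absolutely_continuous_on_interval_def, THEN spec, THEN mp, OF assms(2)]
proof (elim exE conjE)
  fix \<delta> :: real
  assume "\<delta> > 0" and small: "\<forall>(N::nat) l r.
        (\<forall>i<N. a \<le> l i \<and> l i \<le> r i \<and> r i \<le> b) \<longrightarrow>
        (\<forall>i<N. \<forall>j<N. i \<noteq> j \<longrightarrow> {l i<..<r i} \<inter> {l j<..<r j} = {}) \<longrightarrow>
        (\<Sum>i<N. r i - l i) < \<delta> \<longrightarrow>
        (\<Sum>i<N. norm (x (r i) - x (l i))) < \<epsilon>"
  show thesis
    by (rule that[OF \<open>\<delta> > 0\<close>])
      (use small in \<open>simp only: nonoverlapping_intervals_def imp_conjL\<close>)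
qed

lemma absolutely_continuous_on_intervalI:
  assumes "\<And>\<epsilon>. \<epsilon> > 0 \<Longrightarrow> \<exists>\<delta>>0. \<forall>N l r. nonoverlapping_intervals a b N l r \<longrightarrow>
      (\<Sum>i<N. r i - l i) < \<delta> \<longrightarrow> (\<Sum>i<N. norm (x (r i) - x (l i))) < \<epsilon>"
  shows "absolutely_continuous_on_interval a b x"
  using assms
  unfolding absolutely_continuous_on_interval_def nonoverlapping_intervals_def imp_conjL by simp

lemma absolutely_continuous_add:
  assumes x: "absolutely_continuous_on_interval a b x"
    and y: "absolutely_continuous_on_interval a b y"
  shows "absolutely_continuous_on_interval a b (\<lambda>s. x s + y s)"
proof (rule absolutely_continuous_on_intervalI)
  fix \<epsilon> :: real
  assume "\<epsilon> > 0"
  then have half: "\<epsilon> / 2 > 0"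
    by simp
  obtain \<delta>1 where \<delta>1: "\<delta>1 > 0" "\<forall>N l r. nonoverlapping_intervals a b N l r \<longrightarrow>
      (\<Sum>i<N. r i - l i) < \<delta>1 \<longrightarrow> (\<Sum>i<N. norm (x (r i) - x (l i))) < \<epsilon> / 2"
    using absolutely_continuous_on_intervalE[OF x half] .
  obtain \<delta>2 where \<delta>2: "\<delta>2 > 0" "\<forall>N l r. nonoverlapping_intervals a b N l r \<longrightarrow>
      (\<Sum>i<N. r i - l i) < \<delta>2 \<longrightarrow> (\<Sum>i<N. norm (y (r i) - y (l i))) < \<epsilon> / 2"
    using absolutely_continuous_on_intervalE[OF y half] .
  show "\<exists>\<delta>>0. \<forall>N l r. nonoverlapping_intervals a b N l r \<longrightarrow> (\<Sum>i<N. r i - l i) < \<delta> \<longrightarrow>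
      (\<Sum>i<N. norm (x (r i) + y (r i) - (x (l i) + y (l i)))) < \<epsilon>"
  proof (intro exI[of _ "min \<delta>1 \<delta>2"] conjI allI impI)
    show "min \<delta>1 \<delta>2 > 0"
      using \<delta>1(1) \<delta>2(1) by simp
    fix N l r
    assume lr: "nonoverlapping_intervals a b N l r"
      and small: "(\<Sum>i<N. r i - l i) < min \<delta>1 \<delta>2"
    have "(\<Sum>i<N. norm (x (r i) + y (r i) - (x (l i) + y (l i))))
        \<le> (\<Sum>i<N. norm (x (r i) - x (l i)) + norm (y (r i) - y (l i)))"
      by (intro sum_mono norm_diff_triangle_ineq)
    also have "\<dots> = (\<Sum>i<N. norm (x (r i) - x (l i))) + (\<Sum>i<N. norm (y (r i) - y (l i)))"
      by (rule sum.distrib)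
    also have "\<dots> < \<epsilon> / 2 + \<epsilon> / 2"
      using \<delta>1(2)[rule_format, OF lr] \<delta>2(2)[rule_format, OF lr] small by (intro add_strict_mono) auto
    finally show "(\<Sum>i<N. norm (x (r i) + y (r i) - (x (l i) + y (l i)))) < \<epsilon>"
      by simp
  qed
qed

text \<open>
  A nonexpansive nondecreasing change of time sends non-overlapping intervals to
  non-overlapping intervals (some possibly degenerate) of no larger total length, so the same
  \<open>\<delta>\<close> works. Clipping a time to one side of the gluing point is of this kind.
\<close>

lemma absolutely_continuous_compose_mono_nonexpansive:
  assumes x: "absolutely_continuous_on_interval c d x"
    and range: "\<And>s. a \<le> s \<Longrightarrow> s \<le> b \<Longrightarrow> c \<le> \<phi> s \<and> \<phi> s \<le> d"
    and mono: "\<And>s s'. s \<le> s' \<Longrightarrow> \<phi> s \<le> \<phi> s'"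
    and nonexpansive: "\<And>s s'. s \<le> s' \<Longrightarrow> \<phi> s' - \<phi> s \<le> s' - s"
  shows "absolutely_continuous_on_interval a b (\<lambda>s. x (\<phi> s))"
proof (rule absolutely_continuous_on_intervalI)
  fix \<epsilon> :: real
  assume "\<epsilon> > 0"
  obtain \<delta> where \<delta>: "\<delta> > 0" "\<forall>N l r. nonoverlapping_intervals c d N l r \<longrightarrow>
      (\<Sum>i<N. r i - l i) < \<delta> \<longrightarrow> (\<Sum>i<N. norm (x (r i) - x (l i))) < \<epsilon>"
    using absolutely_continuous_on_intervalE[OF x \<open>\<epsilon> > 0\<close>] .
  show "\<exists>\<delta>>0. \<forall>N l r. nonoverlapping_intervals a b N l r \<longrightarrow> (\<Sum>i<N. r i - l i) < \<delta> \<longrightarrow>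
      (\<Sum>i<N. norm (x (\<phi> (r i)) - x (\<phi> (l i)))) < \<epsilon>"
  proof (intro exI[of _ \<delta>] conjI allI impI)
    fix N l r
    assume "nonoverlapping_intervals a b N l r" and small: "(\<Sum>i<N. r i - l i) < \<delta>"
    then have lr: "\<And>i. i < N \<Longrightarrow> a \<le> l i \<and> l i \<le> r i \<and> r i \<le> b"
      and disj: "\<And>i j. i < N \<Longrightarrow> j < N \<Longrightarrow> i \<noteq> j \<Longrightarrow> {l i<..<r i} \<inter> {l j<..<r j} = {}"
      by (auto simp: nonoverlapping_intervals_def)
    have "c \<le> \<phi> (l i) \<and> \<phi> (l i) \<le> \<phi> (r i) \<and> \<phi> (r i) \<le> d" if "i < N" for i
      using lr[OF that] range[of "l i"] range[of "r i"] mono[of "l i" "r i"] by auto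
    moreover have "{\<phi> (l i)<..<\<phi> (r i)} \<inter> {\<phi> (l j)<..<\<phi> (r j)} = {}"
      if "i < N" "j < N" "i \<noteq> j" for i j
    proof -
      have "False" if s: "\<phi> (l i) < s" "s < \<phi> (r i)" "\<phi> (l j) < s" "s < \<phi> (r j)" for s
      proof -
        have reflect: "p < q" if "\<phi> p < s" "s < \<phi> q" for p q
          using mono[of q p] that by linarith
        have "max (l i) (l j) < min (r i) (r j)"
          using s by (simp add: reflect)
        then obtain q where "max (l i) (l j) < q" "q < min (r i) (r j)"
          using dense by blast
        then have "q \<in> {l i<..<r i} \<inter> {l j<..<r j}"
          by simp
        then show False
          using disj[OF \<open>i < N\<close> \<open>j < N\<close> \<open>i \<noteq> j\<close>] by blast
      qed
      then show ?thesis
        unfolding disjoint_iff greaterThanLessThan_iff by blast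
    qed
    ultimately have "nonoverlapping_intervals c d N (\<lambda>i. \<phi> (l i)) (\<lambda>i. \<phi> (r i))"
      unfolding nonoverlapping_intervals_def by blast
    moreover have "(\<Sum>i<N. \<phi> (r i) - \<phi> (l i)) < \<delta>"
    proof -
      have "(\<Sum>i<N. \<phi> (r i) - \<phi> (l i)) \<le> (\<Sum>i<N. r i - l i)"
        using lr nonexpansive by (intro sum_mono) simp
      with small show ?thesis
        by simp
    qed
    ultimately show "(\<Sum>i<N. norm (x (\<phi> (r i)) - x (\<phi> (l i)))) < \<epsilon>"
      by (rule \<delta>(2)[rule_format])
  qed (rule \<delta>(1))
qed

text \<open>
  Instead of splitting the intervals that straddle \<open>t\<close>, write the glued curve as a sum of two
  curves defined for all times: the first one frozen after time \<open>t\<close>, and the increment of the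
  second one, frozen before time \<open>t\<close>.
\<close>

lemma absolutely_continuous_concatenate:
  assumes x: "absolutely_continuous_on_interval 0 t x"
    and y: "absolutely_continuous_on_interval 0 T y"
    and glue: "y 0 = x t" and "t \<ge> 0" "T \<ge> 0"
  shows "absolutely_continuous_on_interval 0 T (concatenate t x y)"
proof -
  have "absolutely_continuous_on_interval 0 T (\<lambda>s. x (min s t))"
    by (rule absolutely_continuous_compose_mono_nonexpansive[OF x]) (use \<open>t \<ge> 0\<close> in auto)
  moreover have "absolutely_continuous_on_interval 0 T (\<lambda>s. y (max 0 (s - t)) + (- y 0))"
  proof (rule absolutely_continuous_add)
    show "absolutely_continuous_on_interval 0 T (\<lambda>s. y (max 0 (s - t)))"
      by (rule absolutely_continuous_compose_mono_nonexpansive[OF y])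
        (use \<open>t \<ge> 0\<close> \<open>T \<ge> 0\<close> in auto)
    show "absolutely_continuous_on_interval 0 T (\<lambda>s. - y 0)"
      unfolding absolutely_continuous_on_interval_def by (auto intro: exI[of _ 1])
  qed
  ultimately have
    "absolutely_continuous_on_interval 0 T (\<lambda>s. x (min s t) + (y (max 0 (s - t)) + (- y 0)))"
    by (rule absolutely_continuous_add)
  moreover have "(\<lambda>s. x (min s t) + (y (max 0 (s - t)) + (- y 0))) = concatenate t x y"
    using glue by (auto simp: concatenate_def fun_eq_iff max_def min_def)
  ultimately show ?thesis
    by simp
qed

section \<open>Concatenation of controls and of solutions\<close>

text \<open>
  Measurability on the half-line is traded for measurability of the extensions by zero, since
  the whole line, unlike the half-line, is invariant under the shift by \<open>t\<close>.
\<close>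

lemma concatenate_controls:
  fixes u v :: "real \<Rightarrow> real ^ 'm"
  assumes u: "u \<in> controls" and v: "v \<in> controls" and "t \<ge> 0"
  shows "concatenate t u v \<in> controls"
proof -
  define u0 where "u0 = (\<lambda>s. if s \<in> {0..} then u s else 0)"
  define v0 where "v0 = (\<lambda>s. if s \<in> {0..} then v s else 0)"
  have u0[measurable]: "u0 \<in> borel_measurable lebesgue"
    and v0: "v0 \<in> borel_measurable lebesgue"
    using u v unfolding controls_def u0_def v0_def
    by (simp_all only: mem_Collect_eq) (rule borel_measurable_if_I; simp)+
  have "(\<lambda>s. s - t) \<in> lebesgue \<rightarrow>\<^sub>M lebesgue"
    using lebesgue_affine_measurable[of "\<lambda>_. 1" "- t"] by simp
  then have [measurable]: "(\<lambda>s. v0 (s - t)) \<in> borel_measurable lebesgue"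
    using v0 by (rule measurable_compose)
  have "(\<lambda>s. if s \<in> {..t} then u0 s else v0 (s - t)) \<in> borel_measurable lebesgue"
    by (intro measurable_If_set u0) auto
  then have "(\<lambda>s. if s \<in> {..t} then u0 s else v0 (s - t)) \<in> borel_measurable (lebesgue_on {0..})"
    by (rule measurable_restrict_space1)
  then have "concatenate t u v \<in> borel_measurable (lebesgue_on {0..})"
    by (rule measurable_cong[THEN iffD1, rotated])
      (auto simp: concatenate_def u0_def v0_def)
  moreover have "concatenate t u v s \<in> U1" if "s \<ge> 0" for s
    using u v that by (auto simp: controls_def concatenate_def)
  ultimately show ?thesis
    by (simp add: controls_def)
qed

lemma AE_lebesgue_half_line_iff_negligible:
  "(AE s in lebesgue_on {0::real..}. P s) \<longleftrightarrow> negligible {s. 0 \<le> s \<and> \<not> P s}"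
proof -
  have "(AE s in lebesgue_on {0::real..}. P s) \<longleftrightarrow> (AE s in lebesgue. 0 \<le> s \<longrightarrow> P s)"
    by (subst AE_restrict_space_iff) auto
  also have "\<dots> \<longleftrightarrow> negligible {s. 0 \<le> s \<and> \<not> P s}"
    unfolding negligible_iff_null_sets
    by (subst completion.AE_iff_null_sets) auto
  finally show ?thesis .
qed

text \<open>
  The differential equation can fail for the concatenation only at \<open>t\<close>, where the control may
  jump, at a time where it fails for \<open>x\<close>, or at the translate by \<open>t\<close> of a time where it fails
  for \<open>y\<close>. After time \<open>t\<close> the shift is harmless because \<open>f\<close> does not depend on time.
\<close>

lemma is_solution_concatenate:
  assumes x: "is_solution f u x0 x" and y: "is_solution f v (x t) y" and "t \<ge> 0"
  shows "is_solution f (concatenate t u v) x0 (concatenate t x y)"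
proof -
  let ?z = "concatenate t x y" and ?w = "concatenate t u v"
  have start: "x 0 = x0" "y 0 = x t"
    using x y by (auto simp: is_solution_def)
  define Nx where
    "Nx = {s. 0 \<le> s \<and> \<not> (x has_vector_derivative f (x s) (u s)) (at s within {0..})}"
  define Ny where
    "Ny = {s. 0 \<le> s \<and> \<not> (y has_vector_derivative f (y s) (v s)) (at s within {0..})}"
  define Nz where
    "Nz = {s. 0 \<le> s \<and> \<not> (?z has_vector_derivative f (?z s) (?w s)) (at s within {0..})}"
  have "negligible Nx" "negligible Ny"
    using x y unfolding is_solution_def AE_lebesgue_half_line_iff_negligible Nx_def Ny_def
    by auto
  then have negligible: "negligible (insert t (Nx \<union> (+) t ` Ny))"
    by (simp add: negligible_translation)
  have "Nz \<subseteq> insert t (Nx \<union> (+) t ` Ny)"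
  proof (rule ccontr)
    assume "\<not> Nz \<subseteq> insert t (Nx \<union> (+) t ` Ny)"
    then obtain s where s: "s \<in> Nz" "s \<noteq> t" "s \<notin> Nx" "s \<notin> (+) t ` Ny"
      by blast
    then have "s \<ge> 0"
      by (simp add: Nz_def)
    have "(?z has_vector_derivative f (?z s) (?w s)) (at s within {0..})"
    proof (cases "s < t")
      case True
      have "(x has_vector_derivative f (x s) (u s)) (at s within {0..})"
        using s \<open>s \<ge> 0\<close> by (simp add: Nx_def)
      then have "(?z has_vector_derivative f (x s) (u s)) (at s within {0..})"
        by (rule has_vector_derivative_transform_within[where d = "t - s"])
          (use True \<open>s \<ge> 0\<close> in \<open>auto simp: concatenate_def dist_real_def\<close>)
      with True show ?thesis
        by (simp add: concatenate_def)
    next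
      case False
      with s have "s > t"
        by simp
      have "s - t \<notin> Ny"
        using s(4) by force
      then have "(y has_vector_derivative f (y (s - t)) (v (s - t))) (at (s - t) within {0..})"
        using \<open>s > t\<close> by (simp add: Ny_def)
      \<comment> \<open>The one-sided neighbourhood of the half-line is two-sided here, so the shift by \<open>t\<close>
        can be handled by the ordinary chain rule.\<close>
      moreover have "at (s - t) within {0..} = at (s - t)"
        using \<open>s > t\<close> by (intro at_within_interior) simp
      ultimately have y': "(y has_vector_derivative f (y (s - t)) (v (s - t))) (at (s - t))"
        by simp
      have "((\<lambda>s. s - t) has_vector_derivative 1) (at s)"
        by (auto intro!: derivative_eq_intros)
      from vector_diff_chain_at[OF this y']
      have "((\<lambda>s. y (s - t)) has_vector_derivative f (y (s - t)) (v (s - t))) (at s)"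
        by (simp add: o_def)
      then have "(?z has_vector_derivative f (y (s - t)) (v (s - t))) (at s)"
        by (rule has_vector_derivative_transform_within_open[where S = "{t<..}"])
          (use \<open>s > t\<close> in \<open>auto simp: concatenate_def\<close>)
      with \<open>s > t\<close> show ?thesis
        by (simp add: concatenate_def has_vector_derivative_at_within)
    qed
    with s(1) show False
      by (simp add: Nz_def)
  qed
  with negligible have "negligible Nz"
    by (rule negligible_subset)
  then have "AE s in lebesgue_on {0..}. (?z has_vector_derivative f (?z s) (?w s)) (at s within {0..})"
    unfolding AE_lebesgue_half_line_iff_negligible Nz_def .
  moreover have "absolutely_continuous_on_interval 0 T ?z" if "T \<ge> 0" for T
    using x y start \<open>t \<ge> 0\<close> that
    by (intro absolutely_continuous_concatenate) (auto simp: is_solution_def)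
  moreover have "?z 0 = x0"
    using start \<open>t \<ge> 0\<close> by (simp add: concatenate_def)
  ultimately show ?thesis
    by (simp add: is_solution_def)
qed

section \<open>Admissibility propagates backwards\<close>

lemma concatenate_in:
  assumes "\<forall>s\<in>{0..t}. x s \<in> B" and "\<And>s. 0 \<le> s \<Longrightarrow> s \<le> T \<Longrightarrow> y s \<in> B"
    and "0 \<le> t" "0 \<le> s" "s \<le> T"
  shows "concatenate t x y s \<in> B"
  using assms by (auto simp: concatenate_def)

text \<open>
  The concatenation satisfies the constraints up to time \<open>t + T\<close>; only \<open>T\<close> is claimed, so that
  the starting point has the same horizon as the point reached.
\<close>

lemma admissible_set_upto_backward:
  assumes u: "u \<in> controls" and x: "is_solution f u x0 x" and "t \<ge> 0"
    and stays: "\<forall>s\<in>{0..t}. x s \<in> constraint_set g"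
    and reached: "x t \<in> admissible_set_upto f g T"
  shows "x0 \<in> admissible_set_upto f g T"
proof -
  obtain v y where v: "v \<in> controls" and y: "is_solution f v (x t) y"
    and y_in: "\<And>s. 0 \<le> s \<Longrightarrow> s \<le> T \<Longrightarrow> y s \<in> constraint_set g"
    using reached by (auto simp: admissible_set_upto_def constraint_set_def)
  have "concatenate t x y s \<in> constraint_set g" if "0 \<le> s" "s \<le> T" for s
    using concatenate_in[OF stays y_in \<open>t \<ge> 0\<close> that] .
  moreover have "x0 \<in> constraint_set g"
    using stays x \<open>t \<ge> 0\<close> by (force simp: is_solution_def)
  ultimately show ?thesis
    using concatenate_controls[OF u v \<open>t \<ge> 0\<close>] is_solution_concatenate[OF x y \<open>t \<ge> 0\<close>]
    unfolding admissible_set_upto_def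
    by (intro CollectI conjI bexI[of _ "concatenate t u v"] exI[of _ "concatenate t x y"])
      (auto simp: constraint_set_def)
qed

lemma admissible_set_backward:
  assumes u: "u \<in> controls" and x: "is_solution f u x0 x" and "t \<ge> 0"
    and stays: "\<forall>s\<in>{0..t}. x s \<in> constraint_set g"
    and reached: "x t \<in> admissible_set f g"
  shows "x0 \<in> admissible_set f g"
proof -
  obtain v y where v: "v \<in> controls" and y: "is_solution f v (x t) y"
    and y_in: "\<And>s. 0 \<le> s \<Longrightarrow> y s \<in> constraint_set g"
    using reached by (auto simp: admissible_set_def constraint_set_def)
  have "concatenate t x y s \<in> constraint_set g" if "0 \<le> s" for s
    using concatenate_in[OF stays y_in \<open>t \<ge> 0\<close> that order_refl] .
  moreover have "x0 \<in> constraint_set g"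
    using stays x \<open>t \<ge> 0\<close> by (force simp: is_solution_def)
  ultimately show ?thesis
    using concatenate_controls[OF u v \<open>t \<ge> 0\<close>] is_solution_concatenate[OF x y \<open>t \<ge> 0\<close>]
    unfolding admissible_set_def
    by (intro CollectI conjI bexI[of _ "concatenate t u v"] exI[of _ "concatenate t x y"])
      (auto simp: constraint_set_def)
qed

theorem proposition5p1:
  fixes f :: "real ^ 'n \<Rightarrow> real ^ 'm \<Rightarrow> real ^ 'n"
    and g :: "real ^ 'n \<Rightarrow> real ^ 'p"
  assumes "smooth_dynamics f"
    and "growth_bound f"
    and "convex_velocities f"
    and "smooth_constraints g"
    and "interior (constraint_set g) \<noteq> {}"
    and "admissible_set f g \<noteq> {}"
    and "constraint_set g - admissible_set f g \<noteq> {}"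
  shows "(\<forall>T\<ge>0. semipermeable_boundary f (constraint_set g) (admissible_set_upto f g T)) \<and>
         semipermeable_boundary f (constraint_set g) (admissible_set f g)"
proof (intro conjI allI impI)
  fix T :: real
  show "semipermeable_boundary f (constraint_set g) (admissible_set_upto f g T)"
    unfolding semipermeable_boundary_def
  proof (intro ballI allI impI)
    fix x0 u x t
    assume "x0 \<in> constraint_set g - admissible_set_upto f g T" "u \<in> controls"
      "is_solution f u x0 x" "t \<ge> 0" and stays: "\<forall>s\<in>{0..t}. x s \<in> constraint_set g"
    then have "x t \<notin> admissible_set_upto f g T"
      using admissible_set_upto_backward by blast
    with stays \<open>t \<ge> 0\<close> show "x t \<in> constraint_set g - admissible_set_upto f g T"
      by simp
  qed
next
  show "semipermeable_boundary f (constraint_set g) (admissible_set f g)"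
    unfolding semipermeable_boundary_def
  proof (intro ballI allI impI)
    fix x0 u x t
    assume "x0 \<in> constraint_set g - admissible_set f g" "u \<in> controls"
      "is_solution f u x0 x" "t \<ge> 0" and stays: "\<forall>s\<in>{0..t}. x s \<in> constraint_set g"
    then have "x t \<notin> admissible_set f g"
      using admissible_set_backward by blast
    with stays \<open>t \<ge> 0\<close> show "x t \<in> constraint_set g - admissible_set f g"
      by simp
  qed
qed

end
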